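(* Let $(P_q)$ be a sequence of $L^2$-normalized Littlewood polynomials such that the frequency of $-1$, $$\mathrm{fr}(-1)=\lim_{q\to+\infty}\frac{\#\{0\le j\le q-1:\ \epsilon_j^{(q)}=-1\}}{q},$$ exists. If $\mathrm{fr}(-1)\notin\left(\tfrac14,\tfrac34\right)$ (open interval), then for every real $\alpha\ge 0$ the sequence $(P_q)$ is not $L^\alpha$-flat.
   Context: $S^1$ is the unit circle and $dz$ the normalized Lebesgue measure on it; all $L^\alpha$ norms are with respect to $dz$. A sequence $(P_q)$ of $L^2$-normalized Littlewood polynomials is indexed by $q$ running through an infinite set of positive integers, with $$P_q(z)=\frac1{\sqrt q}\sum_{j=0}^{q-1}\epsilon^{(q)}_j z^j,\qquad \epsilon^{(q)}_j\in\{+1,-1\},\ z\in S^1 .$$ Flatness: for real $\alpha>0$, a sequence $(P_n)$ of analytic trigonometric polynomials of $L^2(S^1,dz)$ norm $1$ is $L^\alpha$-flat if $|P_n|$ converges to the constant function $1$ in $L^\alpha$, i.e. $\int_{S^1}\big||P_n|-1\big|^\alpha dz\to 0$. For $\alpha=0$, $(P_n)$ is $L^0$-flat if the Mahler measures $M(P_n)=\exp\left(\int_{S^1}\log|P_n(z)|\,dz\right)$ converge to $1$. *)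

theory Defs
  imports "HOL-Analysis.Analysis" "HOL-Computational_Algebra.Polynomial"
begin

text \<open>Normalized Lebesgue (arc length) measure of the unit circle, as a Borel probability measure
  on the complex plane concentrated on the circle.\<close>
definition circle_measure :: "complex measure" where
  "circle_measure = distr (uniform_measure lborel {0..1::real}) borel (\<lambda>t. cis (2 * pi * t))"

text \<open>Analytic trigonometric polynomials are represented by complex polynomials. For nonzero \<open>p\<close>
  the integrand is integrable, and the convention \<open>ln 0 = 0\<close> only affects the finitely many zeros
  of \<open>p\<close> on the circle. For \<open>p = 0\<close> the value is the junk value \<open>1\<close> instead of \<open>0\<close>.\<close>
definition mahler :: "complex poly \<Rightarrow> real" where
  "mahler p = exp (LINT z|circle_measure. ln (cmod (poly p z)))"

text \<open>The filter \<open>F\<close> describes how the index tends to infinity. The notion is meant for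
  polynomials of \<open>L\<^sup>2\<close> norm \<open>1\<close> on the circle and for \<open>\<alpha> \<ge> 0\<close>.\<close>
definition L_flat :: "real \<Rightarrow> 'i filter \<Rightarrow> ('i \<Rightarrow> complex poly) \<Rightarrow> bool" where
  "L_flat \<alpha> F P \<longleftrightarrow>
    (if \<alpha> = 0 then ((\<lambda>i. mahler (P i)) \<longlongrightarrow> 1) F
     else ((\<lambda>i. LINT z|circle_measure. \<bar>cmod (poly (P i) z) - 1\<bar> powr \<alpha>) \<longlongrightarrow> 0) F)"

definition littlewood :: "nat \<Rightarrow> (nat \<Rightarrow> int) \<Rightarrow> complex poly" where
  "littlewood q \<epsilon> = smult (complex_of_real (1 / sqrt (real q))) (\<Sum>j<q. monom (of_int (\<epsilon> j)) j)"

text \<open>\<open>q \<rightarrow> \<infinity>\<close> through the index set \<open>Q\<close>; this filter is proper iff \<open>Q\<close> is infinite.\<close>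
definition at_infinity_in :: "nat set \<Rightarrow> nat filter" where
  "at_infinity_in Q = inf sequentially (principal Q)"

end

theory Submission imports Defs "HOL-Probability.Probability_Measure" "HOL-Computational_Algebra.Fundamental_Theorem_Algebra" begin

text \<open>Flatness in either sense forces \<open>\<integral>|P\<^sub>q| \<longrightarrow> 1\<close>, hence \<open>|P\<^sub>q| \<longrightarrow> 1\<close> in \<open>L\<^sup>2\<close> because \<open>\<integral>|P\<^sub>q|\<^sup>2 = 1\<close>.
  For \<open>\<alpha> = 0\<close> this uses \<open>ln u \<le> u - 1\<close> and the integrability of \<open>ln |P\<^sub>q|\<close>.
  Let \<open>E\<^sub>q\<close> be the Littlewood polynomial with all signs \<open>+1\<close>. The inner product of \<open>P\<^sub>q\<close> and \<open>E\<^sub>q\<close> is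
  the mean of the signs of \<open>P\<^sub>q\<close>, and it is at most \<open>\<integral>||P\<^sub>q| - 1||E\<^sub>q| + \<integral>|E\<^sub>q|\<close>. The first term is
  controlled by the \<open>L\<^sup>2\<close> convergence, and the second vanishes in the limit, since \<open>E\<^sub>q\<close> has \<open>L\<^sup>2\<close> norm
  \<open>1\<close> but concentrates at \<open>z = 1\<close>. So the mean of the signs tends to \<open>0\<close>, that is, \<open>fr = 1/2\<close>.\<close>

section \<open>The arc length measure\<close>

lemma uniform_Icc01_eq_density:
  "uniform_measure lborel {0..1::real} = density lborel (\<lambda>t. ennreal (indicator {0..1} t))"
  unfolding uniform_measure_def by (intro arg_cong[where f = "density lborel"] ext) (auto simp: indicator_def divide_ennreal_def)

lemma cis_2pi_measurable [measurable]:
  "(\<lambda>t. cis (2 * pi * t)) \<in> borel_measurable borel"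
  by (intro borel_measurable_continuous_onI continuous_intros)

lemma sets_circle_measure [measurable_cong, simp]: "sets circle_measure = sets borel"
  by (simp add: circle_measure_def)

lemma space_circle_measure [simp]: "space circle_measure = UNIV"
  by (simp add: circle_measure_def)

lemma prob_space_circle_measure: "prob_space circle_measure"
  unfolding circle_measure_def
  by (intro prob_space.prob_space_distr prob_space_uniform_measure) auto

lemma integrable_circle_iff:
  fixes f :: "complex \<Rightarrow> 'b::{banach, second_countable_topology}"
  assumes [measurable]: "f \<in> borel_measurable borel"
  shows "integrable circle_measure f \<longleftrightarrow> set_integrable lborel {0..1} (\<lambda>t. f (cis (2 * pi * t)))"
  unfolding circle_measure_def uniform_Icc01_eq_density set_integrable_def
  by (subst integrable_distr_eq, measurable) (subst integrable_density, auto)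

lemma integral_circle:
  fixes f :: "complex \<Rightarrow> 'b::{banach, second_countable_topology}"
  assumes [measurable]: "f \<in> borel_measurable borel"
  shows "(LINT z|circle_measure. f z) = (LINT t:{0..1}|lborel. f (cis (2 * pi * t)))"
  unfolding circle_measure_def uniform_Icc01_eq_density set_lebesgue_integral_def
  by (subst integral_distr, measurable) (subst integral_density, auto)

lemma integrable_circle_continuous:
  fixes f :: "complex \<Rightarrow> 'b::{banach, second_countable_topology}"
  assumes "continuous_on UNIV f"
  shows "integrable circle_measure f"
proof -
  have "continuous_on {0..1} (\<lambda>t. f (cis (2 * pi * t)))"
    by (intro continuous_on_compose2[OF assms] continuous_intros) auto
  then show ?thesis
    using borel_integrable_atLeastAtMost' assms
    by (subst integrable_circle_iff) (auto intro: borel_measurable_continuous_onI)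
qed

lemma AE_circle_measure_norm: "AE z in circle_measure. cmod z = 1"
  unfolding circle_measure_def by (subst AE_distr_iff) auto

section \<open>Chord lengths and the absence of atoms\<close>

text \<open>By concavity the graph of \<open>sin (pi * x)\<close> lies above its chord from (0, 0)
  to (1/2, 1).\<close>

lemma two_x_le_sin_pi_x:
  fixes x :: real
  assumes "0 \<le> x" "x \<le> 1 / 2"
  shows "2 * x \<le> sin (pi * x)"
proof -
  have "convex_on {0..1/2} (\<lambda>x. - sin (pi * x))"
    by (rule f''_ge0_imp_convex[where f' = "\<lambda>x. - (pi * cos (pi * x))" and f'' = "\<lambda>x. pi * pi * sin (pi * x)"])
       (auto intro!: derivative_eq_intros mult_nonneg_nonneg sin_ge_zero simp: field_simps)
  from convex_onD[OF this, of "2 * x" 0 "1/2"] assms show ?thesis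
    by simp
qed

text \<open>The chord vanishes only when \<open>t - s\<close> is an integer, that is, at
  \<open>s\<close> or, since 0 and 1 parametrize the same point, possibly at \<open>s - 1\<close> or
  \<open>s + 1\<close>. A product bound with these three zeros isolates finitely many bad parameters
  and splits into a sum under the logarithm.\<close>

lemma dist_circle_ge:
  assumes "0 \<le> s" "s \<le> 1" "0 \<le> t" "t \<le> 1"
  shows "\<bar>t - s\<bar> * \<bar>t - (s - 1)\<bar> * \<bar>t - (s + 1)\<bar> \<le> cmod (cis (2 * pi * t) - cis (2 * pi * s))"
proof -
  define x where "x = \<bar>t - s\<bar>"
  have x: "0 \<le> x" "x \<le> 1" using assms by (auto simp: x_def)
  have "cis (2 * pi * t) - cis (2 * pi * s) = cis (2 * pi * s) * (exp (\<i> * of_real (2 * pi * (t - s))) - 1)"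
    unfolding cis_conv_exp[symmetric] by (simp add: right_diff_distrib cis_mult)
  then have "cmod (cis (2 * pi * t) - cis (2 * pi * s)) = 2 * \<bar>sin (pi * (t - s))\<bar>"
    using dist_exp_i_1[of "2 * pi * (t - s)"] by (simp add: norm_mult)
  also have "\<dots> = 2 * sin (pi * x)"
    using sin_ge_zero[of "pi * x"] x by (auto simp: x_def abs_if algebra_simps sin_diff split: if_splits)
  \<comment> \<open>The sine is symmetric under x -> 1 - x, so the linear bound applies to whichever
    of \<open>x\<close> and \<open>1 - x\<close> is at most 1/2.\<close>
  also have "\<dots> \<ge> 4 * (x * (1 - x))"
  proof (cases "x \<le> 1 / 2")
    case True
    moreover have "x * (1 - x) \<le> x" using x by (simp add: algebra_simps)
    ultimately show ?thesis using two_x_le_sin_pi_x[of x] x by linarith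
  next
    case False
    moreover have "x * (1 - x) \<le> 1 - x" using x by (intro mult_left_le_one_le) auto
    moreover have "sin (pi * (1 - x)) = sin (pi * x)" by (simp add: algebra_simps sin_diff)
    ultimately show ?thesis using two_x_le_sin_pi_x[of "1 - x"] x by simp
  qed
  \<comment> \<open>The factors are 1 + (t - s) and 1 - (t - s), whose product does not depend on
    the sign of t - s.\<close>
  moreover have "\<bar>t - (s - 1)\<bar> * \<bar>t - (s + 1)\<bar> = (1 - x) * (1 + x)"
  proof -
    have "\<bar>t - (s - 1)\<bar> = 1 + (t - s)" "\<bar>t - (s + 1)\<bar> = 1 - (t - s)" using assms by auto
    moreover have "x = t - s \<or> x = - (t - s)" by (auto simp: x_def)
    ultimately show ?thesis by (elim disjE) (simp_all only: diff_minus_eq_add mult.commute add_uminus_conv_diff)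
  qed
  moreover have "x * (1 - x) * (1 + x) \<le> x * (1 - x) * 4"
    using x by (intro mult_left_mono) auto
  ultimately show ?thesis
    unfolding x_def[symmetric] mult.assoc by (simp only: mult.assoc)
qed

lemma unimodular_eq_cis_2pi:
  assumes "cmod a = 1"
  obtains s where "0 \<le> s" "s \<le> 1" "a = cis (2 * pi * s)"
proof -
  obtain u where u: "0 \<le> u" "u < 2 * pi" "a = Complex (cos u) (sin u)"
    using complex_unimodular_polar[OF assms] by blast
  then show ?thesis
    by (intro that[of "u / (2 * pi)"]) (auto simp: complex_eq_iff)
qed

text \<open>A point of the circle has at most three parameters in [0, 1], by the chord bound, and
  these form a null set. Points off the circle are missed almost everywhere.\<close>

lemma AE_circle_measure_neq: "AE z in circle_measure. z \<noteq> a"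
proof (cases "cmod a = 1")
  case True
  then obtain s where s: "0 \<le> s" "s \<le> 1" "a = cis (2 * pi * s)"
    by (rule unimodular_eq_cis_2pi)
  have *: "cis (2 * pi * t) \<noteq> a" if "t \<in> {0..1}" "t \<noteq> s" "t \<noteq> s - 1" "t \<noteq> s + 1" for t
    using dist_circle_ge[of s t] s that by (auto simp: mult_le_0_iff)
  have "AE t in lborel. t \<noteq> s" "AE t in lborel. t \<noteq> s - 1" "AE t in lborel. t \<noteq> s + 1"
    by (auto intro: AE_lborel_singleton)
  then have "AE t in lborel. t \<in> {0..1} \<longrightarrow> cis (2 * pi * t) \<noteq> a"
    by eventually_elim (use * in blast)
  then have "AE t in uniform_measure lborel {0..1}. cis (2 * pi * t) \<noteq> a"
    by (intro AE_uniform_measureI) auto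
  then show ?thesis
    unfolding circle_measure_def by (subst AE_distr_iff) auto
next
  case False
  then show ?thesis
    using AE_circle_measure_norm by (auto elim: eventually_mono)
qed

section \<open>Orthonormality of the monomials\<close>

text \<open>On the circle the integrand is the character of frequency j - k. For nonzero frequency
  it has a 1-periodic antiderivative, so the integral over one period vanishes.\<close>

lemma integral_circle_monomials:
  "(LINT z|circle_measure. z ^ j * cnj z ^ k) = (if j = k then 1 else 0)"
proof -
  define m where "m = real j - real k"
  have eq: "cis (2 * pi * t) ^ j * cnj (cis (2 * pi * t)) ^ k = cis (2 * pi * m * t)" for t
    by (simp add: Complex.DeMoivre cis_cnj cis_mult m_def algebra_simps)
  have "(LINT z|circle_measure. z ^ j * cnj z ^ k) = (LINT t:{0..1}|lborel. cis (2 * pi * m * t))"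
    by (subst integral_circle) (auto simp: eq intro!: borel_measurable_continuous_onI continuous_intros)
  also have "\<dots> = (if j = k then 1 else 0)"
  proof (cases "j = k")
    case True
    then show ?thesis by (simp add: m_def set_lebesgue_integral_def cis_zero)
  next
    case False
    then have "m \<noteq> 0" by (simp add: m_def)
    define F where "F = (\<lambda>t. cis (2 * pi * m * t) / (2 * pi * m * \<i>))"
    have "(LINT t:{0..1}|lborel. cis (2 * pi * m * t)) = F 1 - F 0"
      unfolding set_lebesgue_integral_def
    proof (rule integral_FTC_Icc)
      fix t :: real
      show "(F has_vector_derivative cis (2 * pi * m * t)) (at t within {0..1})"
        unfolding F_def cis_conv_exp using \<open>m \<noteq> 0\<close>
        by (auto intro!: derivative_eq_intros has_vector_derivative_real_field simp: field_simps)
    qed (auto intro!: continuous_intros)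
    moreover have "cis (2 * pi * m) = 1"
      using cis_multiple_2pi[of m] by (simp add: m_def mult_ac)
    ultimately show ?thesis using False by (simp add: F_def cis_zero)
  qed
  finally show ?thesis .
qed

section \<open>Integrability of the logarithm of a polynomial\<close>

lemma set_integrable_inverse_sqrt_abs:
  fixes a b c :: real
  assumes "a \<le> b"
  shows "set_integrable lborel {a..b} (\<lambda>t. inverse (sqrt \<bar>t - c\<bar>))"
proof -
  txt \<open>Since \<open>sqrt\<close> is odd, \<open>2 * sqrt (t - c)\<close> is an antiderivative on both sides of \<open>c\<close>.\<close>
  have "((\<lambda>t. inverse (sqrt \<bar>t - c\<bar>)) has_integral 2 * sqrt (b - c) - 2 * sqrt (a - c)) {a..b}"
  proof (rule fundamental_theorem_of_calculus_interior_strong[where S = "{c}"])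
    fix t assume "t \<in> {a<..<b} - {c}"
    moreover have "sqrt (t - c) = - sqrt (c - t)"
      using real_sqrt_minus[of "c - t"] by simp
    ultimately have *: "(sqrt has_real_derivative inverse (sqrt \<bar>t - c\<bar>) / 2) (at (t - c))"
      by (intro DERIV_real_sqrt_generic) (auto simp: abs_if)
    have "((\<lambda>t. sqrt (t - c)) has_real_derivative inverse (sqrt \<bar>t - c\<bar>) / 2 * 1) (at t)"
      by (rule DERIV_chain2[where f = sqrt and g = "\<lambda>t. t - c", OF *]) (auto intro!: derivative_eq_intros)
    from DERIV_cmult[OF this, of 2]
    show "((\<lambda>t. 2 * sqrt (t - c)) has_vector_derivative inverse (sqrt \<bar>t - c\<bar>)) (at t)"
      unfolding has_real_derivative_iff_has_vector_derivative[symmetric] by simp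
  qed (use assms in \<open>auto intro!: continuous_intros\<close>)
  then have "(\<lambda>t. inverse (sqrt \<bar>t - c\<bar>)) absolutely_integrable_on {a..b}"
    by (intro nonnegative_absolutely_integrable_1) (auto simp: integrable_on_def)
  then show ?thesis
    unfolding set_integrable_def by (subst (asm) integrable_completion) auto
qed

text \<open>This is ln u \<le> u at u = 1 / sqrt x. It replaces the logarithmic singularity by an
  integrable power.\<close>

lemma neg_ln_le_inverse_sqrt:
  assumes "0 < (x::real)"
  shows "- ln x \<le> 2 * inverse (sqrt x)"
proof -
  have "- ln x = 2 * ln (inverse (sqrt x))" using assms by (simp add: ln_inverse ln_sqrt)
  also have "\<dots> \<le> 2 * inverse (sqrt x)" using assms ln_bound[of "inverse (sqrt x)"] by simp
  finally show ?thesis .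
qed

text \<open>The product bound controls the negative part of \<open>ln w\<close> by three separate
  singularities, and \<open>w \<le> 2\<close> controls the positive part.\<close>

lemma abs_ln_le_inverse_sqrt:
  fixes w a b c :: real
  assumes "a * b * c \<le> w" "w \<le> 2" "0 \<le> w" "0 < a" "0 < b" "0 < c"
  shows "\<bar>ln w\<bar> \<le> 2 + 2 * (inverse (sqrt a) + inverse (sqrt b) + inverse (sqrt c))"
proof -
  have w: "0 < w" using assms by (smt (verit) mult_pos_pos)
  have "ln (a * b * c) \<le> ln w" using assms w by (intro ln_mono) auto
  then have "- ln w \<le> - ln a + - ln b + - ln c" using assms by (simp add: ln_mult)
  then have "- ln w \<le> 2 * (inverse (sqrt a) + inverse (sqrt b) + inverse (sqrt c))"
    using neg_ln_le_inverse_sqrt[of a] neg_ln_le_inverse_sqrt[of b] neg_ln_le_inverse_sqrt[of c] assms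
    by (simp add: algebra_simps)
  moreover have "ln w \<le> 2" using ln_bound[of w] w assms by linarith
  moreover have "0 \<le> inverse (sqrt a) + inverse (sqrt b) + inverse (sqrt c)" using assms by simp
  ultimately show ?thesis by (simp add: abs_le_iff)
qed

text \<open>If \<open>a\<close> lies on the circle, the chord bound yields a majorant with three
  inverse square root singularities. Otherwise the distance to \<open>a\<close> stays between two
  positive constants on the circle, so its logarithm is bounded.\<close>

lemma integrable_circle_ln_dist: "integrable circle_measure (\<lambda>z. ln (cmod (z - a)))"
proof (cases "cmod a = 1")
  case True
  then obtain s where s: "0 \<le> s" "s \<le> 1" "a = cis (2 * pi * s)"
    by (rule unimodular_eq_cis_2pi)
  define G where "G = (\<lambda>t. 2 + 2 * (inverse (sqrt \<bar>t - s\<bar>) + inverse (sqrt \<bar>t - (s - 1)\<bar>) + inverse (sqrt \<bar>t - (s + 1)\<bar>)))"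
  have G: "set_integrable lborel {0..1} G"
    unfolding G_def
    by (intro set_integral_add set_integrable_mult_right set_integrable_inverse_sqrt_abs
          borel_integrable_atLeastAtMost' continuous_intros) auto
  have [measurable]: "(\<lambda>z. ln (cmod (z - a))) \<in> borel_measurable borel" by measurable
  have "set_integrable lborel {0..1} (\<lambda>t. ln (cmod (cis (2 * pi * t) - a)))"
  proof (rule set_integrable_bound[OF G])
    have *: "\<bar>ln (cmod (cis (2 * pi * t) - a))\<bar> \<le> \<bar>G t\<bar>"
      if "t \<in> {0..1}" "t \<noteq> s" "t \<noteq> s - 1" "t \<noteq> s + 1" for t
    proof -
      have "cmod (cis (2 * pi * t) - a) \<le> 2"
        using norm_triangle_ineq4[of "cis (2 * pi * t)" a] True by simp
      then have "\<bar>ln (cmod (cis (2 * pi * t) - a))\<bar> \<le> G t"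
        unfolding G_def using that dist_circle_ge[of s t] s
        by (intro abs_ln_le_inverse_sqrt) auto
      then show ?thesis by linarith
    qed
    have "AE t in lborel. t \<noteq> s" "AE t in lborel. t \<noteq> s - 1" "AE t in lborel. t \<noteq> s + 1"
      by (auto intro: AE_lborel_singleton)
    then show "AE t in lborel. t \<in> {0..1} \<longrightarrow> norm (ln (cmod (cis (2 * pi * t) - a))) \<le> norm (G t)"
      unfolding real_norm_def by eventually_elim (use * in blast)
  qed (auto simp: set_borel_measurable_def)
  then show ?thesis by (subst integrable_circle_iff) auto
next
  case False
  interpret prob_space circle_measure by (rule prob_space_circle_measure)
  show ?thesis
  proof (rule integrable_const_bound)
    have "\<bar>ln (cmod (z - a))\<bar> \<le> \<bar>ln \<bar>cmod a - 1\<bar>\<bar> + ln (1 + cmod a)" if "cmod z = 1" for z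
    proof -
      have *: "\<bar>cmod a - 1\<bar> \<le> cmod (z - a)" "cmod (z - a) \<le> 1 + cmod a"
        using norm_triangle_ineq3[of z a] norm_triangle_ineq4[of z a] that by auto
      then have "ln \<bar>cmod a - 1\<bar> \<le> ln (cmod (z - a))" "ln (cmod (z - a)) \<le> ln (1 + cmod a)"
        using False by (auto intro!: ln_mono)
      moreover have "0 \<le> ln (1 + cmod a)" by (intro ln_ge_zero) auto
      ultimately show ?thesis by linarith
    qed
    with AE_circle_measure_norm
    show "AE z in circle_measure. norm (ln (cmod (z - a))) \<le> \<bar>ln \<bar>cmod a - 1\<bar>\<bar> + ln (1 + cmod a)"
      by (auto elim: eventually_mono)
  qed measurable
qed

lemma poly_borel_measurable [measurable]: "poly (p :: complex poly) \<in> borel_measurable borel"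
  by (intro borel_measurable_continuous_onI continuous_intros)

text \<open>Induction on the degree: a root splits off a linear factor, whose logarithm is already
  known to be integrable.\<close>

lemma integrable_circle_ln_poly:
  assumes "p \<noteq> 0"
  shows "integrable circle_measure (\<lambda>z. ln (cmod (poly p z)))"
  using assms
proof (induction "degree p" arbitrary: p rule: less_induct)
  case less
  interpret prob_space circle_measure by (rule prob_space_circle_measure)
  show ?case
  proof (cases "degree p = 0")
    case True
    then obtain c where "p = [:c:]" by (auto elim: degree_eq_zeroE)
    then show ?thesis by simp
  next
    case False
    then obtain a where "poly p a = 0"
      using fundamental_theorem_of_algebra[of p] by (auto simp: constant_degree)
    then obtain r where p: "p = [:-a, 1:] * r" by (auto simp: poly_eq_0_iff_dvd)
    then have r: "r \<noteq> 0" using less.prems by auto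
    then have "degree r < degree p" unfolding p by (subst degree_mult_eq) auto
    then have "integrable circle_measure (\<lambda>z. ln (cmod (poly r z)))" using less.hyps r by blast
    then have int: "integrable circle_measure (\<lambda>z. \<bar>ln (cmod (z - a))\<bar> + \<bar>ln (cmod (poly r z))\<bar>)"
      using integrable_circle_ln_dist[of a] by (intro Bochner_Integration.integrable_add) auto
    \<comment> \<open>At a zero of \<open>p\<close> the left side is 0 by the convention
      \<open>ln 0 = 0\<close>, so the bound holds at every point.\<close>
    have "\<bar>ln (cmod (poly p z))\<bar> \<le> \<bar>ln (cmod (z - a))\<bar> + \<bar>ln (cmod (poly r z))\<bar>" for z
    proof (cases "z = a \<or> poly r z = 0")
      case False
      moreover have "cmod (poly p z) = cmod (z - a) * cmod (poly r z)"
        by (simp add: p flip: norm_mult left_diff_distrib)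
      ultimately show ?thesis by (simp add: ln_mult)
    qed (auto simp: p)
    then show ?thesis
      by (intro Bochner_Integration.integrable_bound[OF int]) auto
  qed
qed

section \<open>Littlewood polynomials\<close>

lemma poly_littlewood:
  "poly (littlewood q a) z = (\<Sum>j<q. of_int (a j) * z ^ j) / sqrt q"
  by (simp add: littlewood_def poly_sum poly_monom divide_inverse mult.commute)

text \<open>After expanding the product into a double sum, orthonormality leaves only the diagonal
  terms. The coefficients are real, so conjugation fixes them.\<close>

lemma integral_circle_littlewood:
  "(LINT z|circle_measure. poly (littlewood q a) z * cnj (poly (littlewood q b) z))
     = (\<Sum>j<q. of_int (a j * b j)) / of_nat q"
proof -
  have "poly (littlewood q a) z * cnj (poly (littlewood q b) z)
      = (\<Sum>j<q. \<Sum>k<q. of_int (a j * b k) / of_nat q * (z ^ j * cnj z ^ k))" for z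
    by (simp add: poly_littlewood sum_product sum_divide_distrib power2_eq_square[symmetric] mult_ac
             flip: of_real_mult of_real_power)
  then have "(LINT z|circle_measure. poly (littlewood q a) z * cnj (poly (littlewood q b) z))
      = (\<Sum>j<q. \<Sum>k<q. of_int (a j * b k) / of_nat q * (if j = k then 1 else 0))"
    by (simp add: integral_circle_monomials integrable_circle_continuous continuous_intros
          del: of_int_mult)
  then show ?thesis
    by (simp add: sum_divide_distrib if_distrib[of "\<lambda>x. _ * x"] cong: if_cong)
qed

lemma integral_circle_littlewood_square:
  assumes "q > 0" "\<forall>j<q. a j \<in> {1, -1}"
  shows "(LINT z|circle_measure. (cmod (poly (littlewood q a) z))\<^sup>2) = 1"
proof -
  have "(\<Sum>j<q. of_int (a j * a j)) = (\<Sum>j<q. (1::complex))"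
    using assms(2) by (intro sum.cong) auto
  then have "complex_of_real (LINT z|circle_measure. (cmod (poly (littlewood q a) z))\<^sup>2) = 1"
    using integral_circle_littlewood[of q a a] \<open>q > 0\<close>
    by (simp add: complex_norm_square del: of_real_power flip: integral_complex_of_real)
  then show ?thesis by (simp only: of_real_eq_1_iff)
qed

lemma littlewood_nonzero:
  assumes "q > 0" "\<forall>j<q. a j \<in> {1, -1}"
  shows "littlewood q a \<noteq> 0"
  using integral_circle_littlewood_square[OF assms] by auto

text \<open>Each sign is 1 minus twice the indicator that it equals -1.\<close>

lemma sum_signs_eq:
  fixes a :: "nat \<Rightarrow> int"
  assumes "\<forall>j<q. a j \<in> {1, -1}"
  shows "(\<Sum>j<q. real_of_int (a j)) = real q - 2 * real (card {j. j < q \<and> a j = -1})"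
proof -
  have "(\<Sum>j<q. real_of_int (a j)) = (\<Sum>j<q. 1 - 2 * (if a j = -1 then 1 else 0))"
    using assms by (intro sum.cong) auto
  also have "\<dots> = real q - 2 * real (card ({..<q} \<inter> {j. a j = -1}))"
    by (simp add: sum_subtractf sum_distrib_left[symmetric] sum.If_cases)
  also have "{..<q} \<inter> {j. a j = -1} = {j. j < q \<and> a j = -1}" by auto
  finally show ?thesis .
qed

section \<open>The all-ones polynomial vanishes in the limit in mean\<close>

text \<open>There is pointwise convergence to 0 away from z = 1, and the constant square norm 1
  supplies uniform integrability: a truncation is handled by dominated convergence, and the excess
  by the square norm.\<close>

lemma integral_circle_dirichlet_tendsto_0:
  "(\<lambda>q. LINT z|circle_measure. cmod (poly (littlewood q (\<lambda>_. 1)) z)) \<longlonglongrightarrow> 0"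
proof -
  interpret prob_space circle_measure by (rule prob_space_circle_measure)
  define E where "E = (\<lambda>q z. cmod (poly (littlewood q (\<lambda>_. 1)) z))"
  have cont: "continuous_on UNIV (E q)" for q
    unfolding E_def by (intro continuous_intros)
  \<comment> \<open>For fixed z \<noteq> 1 the geometric sums stay bounded, while the normalization
    divides them by \<open>sqrt q\<close>.\<close>
  have lim: "(\<lambda>q. E q z) \<longlonglongrightarrow> 0" if "cmod z = 1" "z \<noteq> 1" for z
  proof (rule tendsto_sandwich[OF _ _ tendsto_const])
    have "E q z \<le> 2 / cmod (1 - z) / sqrt q" for q
    proof -
      have "cmod (\<Sum>j<q. z ^ j) = cmod (1 - z ^ q) / cmod (1 - z)"
        using that by (simp add: sum_gp_strict norm_divide)
      also have "\<dots> \<le> 2 / cmod (1 - z)"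
        using norm_triangle_ineq4[of 1 "z ^ q"] that
        by (intro divide_right_mono) (auto simp: norm_power)
      finally have "cmod (\<Sum>j<q. z ^ j) / sqrt q \<le> 2 / cmod (1 - z) / sqrt q"
        by (intro divide_right_mono) auto
      then show ?thesis by (simp add: E_def poly_littlewood norm_divide)
    qed
    then show "\<forall>\<^sub>F q in sequentially. E q z \<le> 2 / cmod (1 - z) / sqrt q" by simp
    show "(\<lambda>q. 2 / cmod (1 - z) / sqrt (real q)) \<longlonglongrightarrow> 0"
      by (intro tendsto_divide_0[OF tendsto_const] filterlim_at_top_imp_at_infinity
            filterlim_compose[OF sqrt_at_top filterlim_real_sequentially])
  qed (auto simp: E_def)
  have "\<forall>\<^sub>F q in sequentially. (LINT z|circle_measure. E q z) < e" if "e > 0" for e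
  proof -
    \<comment> \<open>The truncation level 2 / e makes the constant 2 / e a dominating function and
      leaves an excess of integral at most e / 2.\<close>
    have "(\<lambda>q. LINT z|circle_measure. min (E q z) (2 / e)) \<longlonglongrightarrow> (LINT z|circle_measure. 0)"
    proof (rule integral_dominated_convergence[where w = "\<lambda>_. 2 / e"])
      show "AE z in circle_measure. (\<lambda>q. min (E q z) (2 / e)) \<longlonglongrightarrow> 0"
        using AE_circle_measure_norm AE_circle_measure_neq[of 1]
      proof eventually_elim
        case (elim z)
        then have "(\<lambda>q. min (E q z) (2 / e)) \<longlonglongrightarrow> min 0 (2 / e)"
          by (intro tendsto_min lim tendsto_const) auto
        then show ?case using that by simp
      qed
    qed (use that in \<open>auto simp: E_def\<close>)
    then have "\<forall>\<^sub>F q in sequentially. (LINT z|circle_measure. min (E q z) (2 / e)) < e / 2"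
      using that by (intro order_tendstoD(2)[of _ 0]) auto
    then show ?thesis
      \<comment> \<open>The square norm is 1 only for positive \<open>q\<close>; at
        \<open>q = 0\<close> the polynomial is 0.\<close>
      using eventually_gt_at_top[of 0]
    proof eventually_elim
      case (elim q)
      \<comment> \<open>Above the level 2 / e the factor \<open>e / 2 * E q z\<close> is at least 1,
        so the quadratic term alone dominates \<open>E q z\<close>.\<close>
      have "E q z \<le> min (E q z) (2 / e) + e / 2 * (E q z)\<^sup>2" for z
      proof (cases "E q z \<le> 2 / e")
        case False
        then have "1 \<le> e / 2 * E q z" using that by (simp add: field_simps)
        then have "1 * E q z \<le> e / 2 * E q z * E q z" by (intro mult_right_mono) (auto simp: E_def)
        moreover have "0 < 2 / e" using that by simp
        ultimately have "E q z \<le> 2 / e + e / 2 * (E q z)\<^sup>2"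
          unfolding power2_eq_square mult.assoc by linarith
        then show ?thesis using False by (simp add: min_def)
      qed (use that in auto)
      then have "(LINT z|circle_measure. E q z)
          \<le> (LINT z|circle_measure. min (E q z) (2 / e) + e / 2 * (E q z)\<^sup>2)"
        using cont by (intro integral_mono integrable_circle_continuous continuous_intros) auto
      also have "\<dots> = (LINT z|circle_measure. min (E q z) (2 / e)) + e / 2 * (LINT z|circle_measure. (E q z)\<^sup>2)"
        using cont by (subst Bochner_Integration.integral_add)
          (auto intro!: integrable_circle_continuous continuous_intros)
      also have "(LINT z|circle_measure. (E q z)\<^sup>2) = 1"
        unfolding E_def using elim by (intro integral_circle_littlewood_square) auto
      finally show ?case using elim by simp
    qed
  qed
  moreover have "0 \<le> (LINT z|circle_measure. E q z)" for q
    by (auto simp: E_def)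
  ultimately have "(\<lambda>q. LINT z|circle_measure. E q z) \<longlonglongrightarrow> 0"
    by (intro order_tendstoI) (auto intro: always_eventually less_le_trans)
  then show ?thesis by (simp add: E_def)
qed

section \<open>Flatness\<close>

lemma AE_circle_poly_nonzero:
  assumes "p \<noteq> 0"
  shows "AE z in circle_measure. poly p z \<noteq> 0"
proof -
  have "AE z in circle_measure. \<forall>a\<in>{a. poly p a = 0}. z \<noteq> a"
    using assms by (intro AE_finite_allI AE_circle_measure_neq poly_roots_finite)
  then show ?thesis by (auto elim: eventually_mono)
qed

text \<open>Expanding the square shows that, at square norm 1, L2 distance of the modulus from 1 and
  the deficit of the mean modulus are the same quantity.\<close>

lemma integral_circle_norm_minus_1_square:
  assumes "(LINT z|circle_measure. (cmod (poly p z))\<^sup>2) = 1"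
  shows "(LINT z|circle_measure. (cmod (poly p z) - 1)\<^sup>2) = 2 - 2 * (LINT z|circle_measure. cmod (poly p z))"
proof -
  interpret prob_space circle_measure by (rule prob_space_circle_measure)
  have int: "integrable circle_measure (\<lambda>z. (cmod (poly p z))\<^sup>2)"
            "integrable circle_measure (\<lambda>z. 2 * cmod (poly p z))"
    by (intro integrable_circle_continuous continuous_intros)+
  have "(\<lambda>z. (cmod (poly p z) - 1)\<^sup>2) = (\<lambda>z. (cmod (poly p z))\<^sup>2 - 2 * cmod (poly p z) + 1)"
    by (auto simp: power2_eq_square algebra_simps)
  then show ?thesis using assms int by (simp add: prob_space[simplified])
qed

lemma integral_circle_norm_le_1:
  assumes "(LINT z|circle_measure. (cmod (poly p z))\<^sup>2) = 1"
  shows "(LINT z|circle_measure. cmod (poly p z)) \<le> 1"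
proof -
  have "0 \<le> (LINT z|circle_measure. (cmod (poly p z) - 1)\<^sup>2)" by simp
  then show ?thesis using integral_circle_norm_minus_1_square[OF assms] by linarith
qed

lemma integral_circle_norm_ge_ln_mahler:
  assumes "p \<noteq> 0"
  shows "1 + ln (mahler p) \<le> (LINT z|circle_measure. cmod (poly p z))"
proof -
  interpret prob_space circle_measure by (rule prob_space_circle_measure)
  have int: "integrable circle_measure (\<lambda>z. cmod (poly p z))"
    by (intro integrable_circle_continuous continuous_intros)
  have "(LINT z|circle_measure. ln (cmod (poly p z))) \<le> (LINT z|circle_measure. cmod (poly p z) - 1)"
  proof (rule integral_mono_AE)
    \<comment> \<open>Zeros of \<open>p\<close> must be discarded: with \<open>ln 0 = 0\<close> the
      inequality fails there.\<close>
    show "AE z in circle_measure. ln (cmod (poly p z)) \<le> cmod (poly p z) - 1"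
      using AE_circle_poly_nonzero[OF assms] by eventually_elim (auto intro: ln_le_minus_one)
  qed (use assms int in \<open>auto intro: integrable_circle_ln_poly\<close>)
  then show ?thesis using int by (simp add: mahler_def prob_space[simplified])
qed

text \<open>One term serves each range: the constant for h \<le> d, the power for d < h \<le> 1 / d,
  and the square for h > 1 / d. This lets a small power integral, even of exponent below 1, combine
  with a bounded square integral to control the mean of \<open>h\<close>.\<close>

lemma le_delta_powr_square:
  fixes h d \<alpha> :: real
  assumes "0 < d" "0 \<le> h" "0 < \<alpha>"
  shows "h \<le> d + 1 / (d * d powr \<alpha>) * h powr \<alpha> + d * h\<^sup>2"
proof -
  have nonneg: "0 \<le> 1 / (d * d powr \<alpha>) * h powr \<alpha>" "0 \<le> d * h\<^sup>2" using assms by auto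
  consider "h \<le> d" | "d < h" "h \<le> 1 / d" | "1 / d < h" by linarith
  then show ?thesis
  proof cases
    case 1
    then show ?thesis using nonneg by linarith
  next
    case 2
    have "1 \<le> h powr \<alpha> / d powr \<alpha>" using 2 assms powr_mono2[of \<alpha> d h] by simp
    then have "1 / d * 1 \<le> 1 / d * (h powr \<alpha> / d powr \<alpha>)" using assms by (intro mult_left_mono) auto
    then have "h \<le> 1 / (d * d powr \<alpha>) * h powr \<alpha>" using 2 by simp
    then show ?thesis using nonneg assms by linarith
  next
    case 3
    then have "1 \<le> d * h" using assms by (simp add: field_simps)
    then have "1 * h \<le> d * h * h" using assms by (intro mult_right_mono) auto
    then have "h \<le> d * h\<^sup>2" by (simp add: power2_eq_square)
    then show ?thesis using nonneg assms by linarith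
  qed
qed

text \<open>Integrate the three-range bound for the deviation of the modulus from 1. The square of
  the deviation has integral at most 2, so the errors d and 2 * d add up to 3 * d.\<close>

lemma integral_circle_norm_ge_powr:
  assumes "0 < d" "0 < \<alpha>" and norm: "(LINT z|circle_measure. (cmod (poly p z))\<^sup>2) = 1"
  shows "1 - 3 * d - 1 / (d * d powr \<alpha>) * (LINT z|circle_measure. \<bar>cmod (poly p z) - 1\<bar> powr \<alpha>)
    \<le> (LINT z|circle_measure. cmod (poly p z))"
proof -
  interpret prob_space circle_measure by (rule prob_space_circle_measure)
  define C where "C = 1 / (d * d powr \<alpha>)"
  \<comment> \<open>Positivity of \<alpha> makes the power continuous also where the modulus equals
    1.\<close>
  have int: "integrable circle_measure (\<lambda>z. cmod (poly p z))"
    "integrable circle_measure (\<lambda>z. C * \<bar>cmod (poly p z) - 1\<bar> powr \<alpha>)"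
    "integrable circle_measure (\<lambda>z. d * (cmod (poly p z) - 1)\<^sup>2)"
    using assms(2) by (auto intro!: integrable_circle_continuous continuous_intros continuous_on_powr')
  have "1 - (LINT z|circle_measure. cmod (poly p z)) = (LINT z|circle_measure. 1 - cmod (poly p z))"
    using int by (simp add: prob_space[simplified])
  also have "\<dots> \<le> (LINT z|circle_measure. d + C * \<bar>cmod (poly p z) - 1\<bar> powr \<alpha> + d * (cmod (poly p z) - 1)\<^sup>2)"
  proof (rule integral_mono)
    show "1 - cmod (poly p z) \<le> d + C * \<bar>cmod (poly p z) - 1\<bar> powr \<alpha> + d * (cmod (poly p z) - 1)\<^sup>2" for z
      using le_delta_powr_square[of d "\<bar>cmod (poly p z) - 1\<bar>" \<alpha>] assms by (auto simp: C_def)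
  qed (use int in auto)
  also have "\<dots> = d + C * (LINT z|circle_measure. \<bar>cmod (poly p z) - 1\<bar> powr \<alpha>)
      + d * (LINT z|circle_measure. (cmod (poly p z) - 1)\<^sup>2)"
    using int by (simp add: prob_space[simplified])
  also have "(LINT z|circle_measure. (cmod (poly p z) - 1)\<^sup>2) \<le> 2"
    unfolding integral_circle_norm_minus_1_square[OF norm] by simp
  finally show ?thesis using \<open>0 < d\<close> by (simp add: C_def)
qed

text \<open>The square norm bounds the mean modulus above by 1. Flatness supplies the matching lower
  bound, through the Mahler measure for \<alpha> = 0 and through the power integral for \<alpha> >
  0.\<close>

lemma L_flat_imp_integral_norm_tendsto_1:
  assumes "0 \<le> \<alpha>" and flat: "L_flat \<alpha> F P"
    and nz: "\<forall>\<^sub>F i in F. P i \<noteq> 0"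
    and norm: "\<forall>\<^sub>F i in F. (LINT z|circle_measure. (cmod (poly (P i) z))\<^sup>2) = 1"
  shows "((\<lambda>i. LINT z|circle_measure. cmod (poly (P i) z)) \<longlongrightarrow> 1) F"
proof (rule order_tendstoI)
  fix b :: real assume "1 < b"
  then show "\<forall>\<^sub>F i in F. (LINT z|circle_measure. cmod (poly (P i) z)) < b"
    using norm by (auto elim!: eventually_mono dest: integral_circle_norm_le_1)
next
  fix b :: real assume b: "b < 1"
  show "\<forall>\<^sub>F i in F. b < (LINT z|circle_measure. cmod (poly (P i) z))"
  proof (cases "\<alpha> = 0")
    case True
    then have "((\<lambda>i. 1 + ln (mahler (P i))) \<longlongrightarrow> 1 + ln 1) F"
      using flat by (intro tendsto_intros) (auto simp: L_flat_def)
    then have "\<forall>\<^sub>F i in F. b < 1 + ln (mahler (P i))"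
      using b by (intro order_tendstoD(1)[of _ 1]) auto
    then show ?thesis
      using nz by eventually_elim (use integral_circle_norm_ge_ln_mahler in fastforce)
  next
    case False
    \<comment> \<open>With this choice 1 - 3 * d is the midpoint of \<open>b\<close> and 1, so the
      limit of the lower bound exceeds \<open>b\<close>.\<close>
    define d where "d = (1 - b) / 6"
    have d: "0 < d" using b by (simp add: d_def)
    have "((\<lambda>i. 1 - 3 * d - 1 / (d * d powr \<alpha>) * (LINT z|circle_measure. \<bar>cmod (poly (P i) z) - 1\<bar> powr \<alpha>))
        \<longlongrightarrow> 1 - 3 * d - 1 / (d * d powr \<alpha>) * 0) F"
      using flat False by (intro tendsto_intros) (simp add: L_flat_def)
    then have "\<forall>\<^sub>F i in F. b < 1 - 3 * d - 1 / (d * d powr \<alpha>) * (LINT z|circle_measure. \<bar>cmod (poly (P i) z) - 1\<bar> powr \<alpha>)"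
      using b by (intro order_tendstoD(1)[of _ "1 - 3 * d"]) (simp, simp add: d_def field_simps)
    then show ?thesis
      using norm by eventually_elim (use integral_circle_norm_ge_powr[of d \<alpha>] d False \<open>0 \<le> \<alpha>\<close> in force)
  qed
qed

section \<open>The mean of the signs and the contradiction\<close>

text \<open>The sign mean is the inner product with the all-ones polynomial E. Writing |f||E| as
  (|f| - 1)|E| + |E|, the first term is split by a weighted arithmetic-geometric mean inequality
  with free weight \<open>d\<close>.\<close>

lemma abs_sign_mean_le:
  assumes "q > 0" and signs: "\<forall>j<q. a j \<in> {1, -1}" and "0 < d"
  shows "\<bar>\<Sum>j<q. real_of_int (a j)\<bar> / q
    \<le> (1 - (LINT z|circle_measure. cmod (poly (littlewood q a) z))) / d + d / 2
      + (LINT z|circle_measure. cmod (poly (littlewood q (\<lambda>_. 1)) z))"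
proof -
  define f where "f = poly (littlewood q a)"
  define E where "E = poly (littlewood q (\<lambda>_. 1))"
  have cont [continuous_intros]: "continuous_on UNIV f" "continuous_on UNIV E"
    unfolding f_def E_def by (intro continuous_intros)+
  have int: "integrable circle_measure (\<lambda>z. (cmod (f z) - 1)\<^sup>2 / (2 * d))"
    "integrable circle_measure (\<lambda>z. d / 2 * (cmod (E z))\<^sup>2)"
    "integrable circle_measure (\<lambda>z. cmod (E z))" "integrable circle_measure (\<lambda>z. cmod (f z) * cmod (E z))"
    using \<open>0 < d\<close> by (auto intro!: integrable_circle_continuous continuous_intros)
  have "(LINT z|circle_measure. f z * cnj (E z)) = complex_of_real ((\<Sum>j<q. real_of_int (a j)) / q)"
    unfolding f_def E_def by (simp add: integral_circle_littlewood)
  then have "\<bar>\<Sum>j<q. real_of_int (a j)\<bar> / q = cmod (LINT z|circle_measure. f z * cnj (E z))"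
    by (simp only: norm_of_real) simp
  also have "\<dots> \<le> (LINT z|circle_measure. cmod (f z) * cmod (E z))"
    using integral_norm_bound[of circle_measure "\<lambda>z. f z * cnj (E z)"] by (simp add: norm_mult)
  also have "\<dots> \<le> (LINT z|circle_measure. (cmod (f z) - 1)\<^sup>2 / (2 * d) + d / 2 * (cmod (E z))\<^sup>2 + cmod (E z))"
  proof (rule integral_mono)
    fix z
    \<comment> \<open>Divide the nonnegative square of (|f| - 1) - d|E| by 2 * d.\<close>
    have "(cmod (f z) - 1) * cmod (E z) \<le> (cmod (f z) - 1)\<^sup>2 / (2 * d) + d / 2 * (cmod (E z))\<^sup>2"
      using zero_le_power2[of "cmod (f z) - 1 - d * cmod (E z)"] \<open>0 < d\<close>
      by (simp add: field_simps power2_eq_square)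
    then show "cmod (f z) * cmod (E z) \<le> (cmod (f z) - 1)\<^sup>2 / (2 * d) + d / 2 * (cmod (E z))\<^sup>2 + cmod (E z)"
      by (simp add: left_diff_distrib)
  qed (use int in auto)
  also have "\<dots> = (LINT z|circle_measure. (cmod (f z) - 1)\<^sup>2) / (2 * d)
      + d / 2 * (LINT z|circle_measure. (cmod (E z))\<^sup>2) + (LINT z|circle_measure. cmod (E z))"
    using int by simp
  also have "(LINT z|circle_measure. (cmod (E z))\<^sup>2) = 1"
    unfolding E_def using \<open>q > 0\<close> by (intro integral_circle_littlewood_square) auto
  also have "(LINT z|circle_measure. (cmod (f z) - 1)\<^sup>2) = 2 - 2 * (LINT z|circle_measure. cmod (f z))"
    unfolding f_def using assms
    by (intro integral_circle_norm_minus_1_square integral_circle_littlewood_square)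
  finally show ?thesis
    using \<open>0 < d\<close> by (simp add: f_def E_def field_simps)
qed

theorem theorem2p1:
  fixes Q :: "nat set" and \<epsilon> :: "nat \<Rightarrow> nat \<Rightarrow> int" and fr :: real
  assumes "infinite Q" and "\<forall>q\<in>Q. q > 0"
    and "\<forall>q\<in>Q. \<forall>j<q. \<epsilon> q j \<in> {1, -1}"
    and "((\<lambda>q. real (card {j. j < q \<and> \<epsilon> q j = -1}) / real q) \<longlongrightarrow> fr) (at_infinity_in Q)"
    and "fr \<notin> {1/4<..<3/4}"
  shows "\<forall>\<alpha>\<ge>0. \<not> L_flat \<alpha> (at_infinity_in Q) (\<lambda>q. littlewood q (\<epsilon> q))"
proof (intro allI impI notI)
  fix \<alpha> :: real
  assume \<alpha>: "0 \<le> \<alpha>" and flat: "L_flat \<alpha> (at_infinity_in Q) (\<lambda>q. littlewood q (\<epsilon> q))"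
  let ?F = "at_infinity_in Q"
  have Q: "\<forall>\<^sub>F q in ?F. q \<in> Q"
    unfolding at_infinity_in_def by (simp add: eventually_inf_principal)
  \<comment> \<open>Infinitude of \<open>Q\<close> makes the filter proper, so inequalities pass to
    limits.\<close>
  have "?F \<noteq> bot"
    using assms(1) unfolding at_infinity_in_def trivial_limit_def
    by (auto simp: eventually_inf_principal eventually_sequentially infinite_nat_iff_unbounded_le)
  \<comment> \<open>\<open>m\<close> is the limit of the absolute sign mean, positive because 1/2
    lies in the excluded interval. Taking it also as the weight \<open>d\<close> makes the upper
    bound tend to m / 2, which contradicts m > 0.\<close>
  define m where "m = \<bar>1 - 2 * fr\<bar>"
  have "m > 0" using assms(5) by (auto simp: m_def)
  have "((\<lambda>q. LINT z|circle_measure. cmod (poly (littlewood q (\<epsilon> q)) z)) \<longlongrightarrow> 1) ?F"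
  proof (rule L_flat_imp_integral_norm_tendsto_1[OF \<alpha> flat])
    show "\<forall>\<^sub>F q in ?F. littlewood q (\<epsilon> q) \<noteq> 0"
      using Q by eventually_elim (rule littlewood_nonzero, use assms(2,3) in auto)
    show "\<forall>\<^sub>F q in ?F. (LINT z|circle_measure. (cmod (poly (littlewood q (\<epsilon> q)) z))\<^sup>2) = 1"
      using Q by eventually_elim (rule integral_circle_littlewood_square, use assms(2,3) in auto)
  qed
  moreover have "((\<lambda>q. LINT z|circle_measure. cmod (poly (littlewood q (\<lambda>_. 1)) z)) \<longlongrightarrow> 0) ?F"
    unfolding at_infinity_in_def
    by (rule tendsto_mono[OF inf_le1 integral_circle_dirichlet_tendsto_0])
  ultimately have "((\<lambda>q. (1 - (LINT z|circle_measure. cmod (poly (littlewood q (\<epsilon> q)) z))) / m + m / 2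
      + (LINT z|circle_measure. cmod (poly (littlewood q (\<lambda>_. 1)) z))) \<longlongrightarrow> (1 - 1) / m + m / 2 + 0) ?F"
    using \<open>m > 0\<close> by (intro tendsto_add tendsto_divide tendsto_diff tendsto_const) auto
  moreover have "((\<lambda>q. \<bar>1 - 2 * (real (card {j. j < q \<and> \<epsilon> q j = -1}) / real q)\<bar>) \<longlongrightarrow> m) ?F"
    unfolding m_def by (rule tendsto_rabs[OF tendsto_diff[OF tendsto_const tendsto_mult_left[OF assms(4)]]])
  moreover have "\<forall>\<^sub>F q in ?F. \<bar>1 - 2 * (real (card {j. j < q \<and> \<epsilon> q j = -1}) / real q)\<bar>
      \<le> (1 - (LINT z|circle_measure. cmod (poly (littlewood q (\<epsilon> q)) z))) / m + m / 2
      + (LINT z|circle_measure. cmod (poly (littlewood q (\<lambda>_. 1)) z))"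
    using Q
  proof eventually_elim
    case (elim q)
    then have q: "q > 0" "\<forall>j<q. \<epsilon> q j \<in> {1, -1}" using assms(2,3) by simp_all
    have "1 - 2 * (real (card {j. j < q \<and> \<epsilon> q j = -1}) / real q) = (\<Sum>j<q. real_of_int (\<epsilon> q j)) / q"
      unfolding sum_signs_eq[OF q(2)] using q(1) by (simp add: field_simps)
    then show ?case
      using abs_sign_mean_le[OF q \<open>m > 0\<close>] by simp
  qed
  ultimately have "m \<le> (1 - 1) / m + m / 2 + 0"
    by (rule tendsto_le[OF \<open>?F \<noteq> bot\<close>])
  then show False using \<open>m > 0\<close> by simp
qed

end
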